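(* Let $\varphi_0$ be a seed function on an interval $(a,b)$, let $\langle\cdot,\cdot\rangle$ be an inner product on $\mathcal{K}_\infty(\varphi_0)=\bigcup_{n\ge 1}\mathcal{K}_n(\varphi_0)$ satisfying the Integration-by-Parts property, and suppose that $\|\varphi_0\|=1$. Then the differential Lanczos algorithm started from $\varphi_0$ generates (well-defined) sequences $\Phi=\{\varphi_n\}_{n=0}^\infty$, $\{b_n\}_{n=0}^\infty$ and $\{c_n\}_{n=0}^\infty$ such that for all $n=1,2,\ldots$: (i) $\{\varphi_0,\ldots,\varphi_n\}$ is an orthonormal basis of $\mathcal{K}_{n+1}(\varphi_0)$ with respect to $\langle\cdot,\cdot\rangle$; (ii) $\varphi_{n-1}'=-b_{n-2}\varphi_{n-2}+\mathrm{i}\,c_{n-1}\varphi_{n-1}+b_{n-1}\varphi_n$, where for $n=1$ the term $b_{-1}\varphi_{-1}$ is taken to be identically $0$.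
   Context: Functions are complex-valued and infinitely differentiable on an interval $(a,b)$ with $-\infty\le a<b\le\infty$; spans are over $\mathbb{C}$. Inner products are linear in the first argument and conjugate-linear in the second, and $\|f\|=\sqrt{\langle f,f\rangle}$. Seed function: a smooth function $\varphi_0$ that is not a solution of any (nontrivial) homogeneous linear ordinary differential equation with constant coefficients. Differential Krylov space: for smooth $g$ and $n\ge 1$, $\mathcal{K}_n(g)=\mathrm{span}\{g,g',\ldots,g^{(n-1)}\}$. Integration-by-Parts (IbP) property: $\mathrm{Re}\,(\langle f',g\rangle+\langle f,g'\rangle)=0$ for all $f,g\in\mathcal{K}_\infty(\varphi_0)=\mathrm{span}\{\varphi_0^{(n)}\}_{n\ge 0}$. Differential Lanczos algorithm: put $b_{-1}\varphi_{-1}\equiv 0$ and for $n=0,1,2,\ldots$ set, in this order, $$c_n=-\mathrm{i}\,\langle\varphi_n',\varphi_n\rangle,\qquad \psi_{n+1}=\varphi_n'+b_{n-1}\varphi_{n-1}-\mathrm{i}\,c_n\varphi_n,\qquad b_n=\|\psi_{n+1}\|,\qquad \varphi_{n+1}=b_n^{-1}\psi_{n+1}.$$ *)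

theory Defs
  imports "HOL-Analysis.Analysis" "HOL-Library.Function_Algebras"
begin

text \<open>
  A complex-valued function on an open interval \<open>I\<close> is represented by its extension by zero to
  the whole real line, so that equality of representatives is equality on \<open>I\<close> and the
  representatives form a complex vector space under the pointwise operations.
\<close>

definition cscale :: "complex \<Rightarrow> (real \<Rightarrow> complex) \<Rightarrow> (real \<Rightarrow> complex)"
  where "cscale z f = (\<lambda>x. z * f x)"

global_interpretation cfun: vector_space cscale
  by unfold_locales (auto simp: cscale_def fun_eq_iff algebra_simps)

definition deriv_on :: "real set \<Rightarrow> (real \<Rightarrow> complex) \<Rightarrow> (real \<Rightarrow> complex)"
  where "deriv_on I f = (\<lambda>x. if x \<in> I then vector_derivative f (at x) else 0)"

definition smooth_fun :: "real set \<Rightarrow> (real \<Rightarrow> complex) \<Rightarrow> bool"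
  where "smooth_fun I f \<longleftrightarrow>
    (\<forall>x. x \<notin> I \<longrightarrow> f x = 0) \<and>
    (\<forall>k. \<forall>x\<in>I. ((deriv_on I ^^ k) f) differentiable (at x))"

definition seed_function :: "real set \<Rightarrow> (real \<Rightarrow> complex) \<Rightarrow> bool"
  where "seed_function I f \<longleftrightarrow>
    smooth_fun I f \<and>
    \<not> (\<exists>(m::nat) (q::nat \<Rightarrow> complex).
        (\<exists>k\<le>m. q k \<noteq> 0) \<and>
        (\<forall>x\<in>I. (\<Sum>k\<le>m. q k * (deriv_on I ^^ k) f x) = 0))"

definition krylov :: "real set \<Rightarrow> nat \<Rightarrow> (real \<Rightarrow> complex) \<Rightarrow> (real \<Rightarrow> complex) set"
  where "krylov I n g = cfun.span ((\<lambda>k. (deriv_on I ^^ k) g) ` {..<n})"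

definition krylov_inf :: "real set \<Rightarrow> (real \<Rightarrow> complex) \<Rightarrow> (real \<Rightarrow> complex) set"
  where "krylov_inf I g = (\<Union>n\<in>{1..}. krylov I n g)"

lemma krylov_inf_eq_span:
  "krylov_inf I g = cfun.span (range (\<lambda>k. (deriv_on I ^^ k) g))" (is "_ = cfun.span ?R")
proof
  show "krylov_inf I g \<subseteq> cfun.span ?R"
    unfolding krylov_inf_def krylov_def by (intro UN_least cfun.span_mono) auto
  show "cfun.span ?R \<subseteq> krylov_inf I g"
  proof
    fix f assume "f \<in> cfun.span ?R"
    then obtain T r where T: "finite T" "T \<subseteq> ?R" and f: "f = (\<Sum>t\<in>T. cscale (r t) t)"
      unfolding cfun.span_explicit by blast
    from finite_subset_image[OF T] obtain J
      where J: "finite J" "T = (\<lambda>k. (deriv_on I ^^ k) g) ` J" by blast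
    from J(1) obtain m where "J \<subseteq> {..<m}" by (auto simp: finite_nat_iff_bounded)
    then have "J \<subseteq> {..<Suc m}" by auto
    then have "T \<subseteq> krylov I (Suc m) g"
      unfolding krylov_def J(2) by (intro subset_trans[OF image_mono cfun.span_superset])
    then have "f \<in> krylov I (Suc m) g"
      unfolding f krylov_def by (intro cfun.span_sum cfun.span_scale) auto
    then show "f \<in> krylov_inf I g"
      unfolding krylov_inf_def by (intro UN_I[of "Suc m"]) auto
  qed
qed

text \<open>
  A form is a function on all of \<open>real \<Rightarrow> complex\<close>; only its values on \<open>V\<close> are constrained.
  Conjugate-linearity in the second argument follows from conjugate symmetry, which also makes
  \<open>ip f f\<close> real, so that \<open>ip_norm\<close> is the square root of \<open>ip f f\<close>.
\<close>

definition inner_product_on ::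
    "(real \<Rightarrow> complex) set \<Rightarrow> ((real \<Rightarrow> complex) \<Rightarrow> (real \<Rightarrow> complex) \<Rightarrow> complex) \<Rightarrow> bool"
  where "inner_product_on V ip \<longleftrightarrow>
    (\<forall>f\<in>V. \<forall>g\<in>V. \<forall>h\<in>V. ip (f + g) h = ip f h + ip g h) \<and>
    (\<forall>f\<in>V. \<forall>g\<in>V. \<forall>z. ip (cscale z f) g = z * ip f g) \<and>
    (\<forall>f\<in>V. \<forall>g\<in>V. ip g f = cnj (ip f g)) \<and>
    (\<forall>f\<in>V. f \<noteq> 0 \<longrightarrow> Re (ip f f) > 0)"

definition ip_norm ::
    "((real \<Rightarrow> complex) \<Rightarrow> (real \<Rightarrow> complex) \<Rightarrow> complex) \<Rightarrow> (real \<Rightarrow> complex) \<Rightarrow> real"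
  where "ip_norm ip f = sqrt (Re (ip f f))"

definition ibp_property ::
    "real set \<Rightarrow> (real \<Rightarrow> complex) \<Rightarrow>
     ((real \<Rightarrow> complex) \<Rightarrow> (real \<Rightarrow> complex) \<Rightarrow> complex) \<Rightarrow> bool"
  where "ibp_property I \<phi>0 ip \<longleftrightarrow>
    (\<forall>f\<in>krylov_inf I \<phi>0. \<forall>g\<in>krylov_inf I \<phi>0.
       Re (ip (deriv_on I f) g + ip f (deriv_on I g)) = 0)"

text \<open>
  The family \<open>v 0, \<dots>, v n\<close> is an orthonormal basis of \<open>V\<close>. Orthonormality of the indexed family
  forces the \<open>v i\<close> to be pairwise distinct, so independence of the image set is independence of
  the family.
\<close>

definition orthonormal_basis ::
    "((real \<Rightarrow> complex) \<Rightarrow> (real \<Rightarrow> complex) \<Rightarrow> complex) \<Rightarrow>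
     (real \<Rightarrow> complex) set \<Rightarrow> nat \<Rightarrow> (nat \<Rightarrow> real \<Rightarrow> complex) \<Rightarrow> bool"
  where "orthonormal_basis ip V n v \<longleftrightarrow>
    (\<forall>i\<le>n. \<forall>j\<le>n. ip (v i) (v j) = (if i = j then 1 else 0)) \<and>
    cfun.independent (v ` {..n}) \<and>
    cfun.span (v ` {..n}) = V"

text \<open>
  The algorithm, indexed as usual: \<open>lanczos_psi\<close> starts at index 1 (its value at 0 is never used),
  and \<open>lanczos_psi\<close> at index 1 omits the vanishing term with index \<open>-1\<close>. Since
  \<open>inverse 0 = 0\<close>, the recursion is total even if some \<open>lanczos_b\<close> vanishes; that this does not
  happen has to be stated separately.
\<close>

function
      lanczos_phi :: "real set \<Rightarrow> ((real \<Rightarrow> complex) \<Rightarrow> (real \<Rightarrow> complex) \<Rightarrow> complex) \<Rightarrow>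
        (real \<Rightarrow> complex) \<Rightarrow> nat \<Rightarrow> (real \<Rightarrow> complex)"
  and lanczos_psi :: "real set \<Rightarrow> ((real \<Rightarrow> complex) \<Rightarrow> (real \<Rightarrow> complex) \<Rightarrow> complex) \<Rightarrow>
        (real \<Rightarrow> complex) \<Rightarrow> nat \<Rightarrow> (real \<Rightarrow> complex)"
  and lanczos_b :: "real set \<Rightarrow> ((real \<Rightarrow> complex) \<Rightarrow> (real \<Rightarrow> complex) \<Rightarrow> complex) \<Rightarrow>
        (real \<Rightarrow> complex) \<Rightarrow> nat \<Rightarrow> real"
  and lanczos_c :: "real set \<Rightarrow> ((real \<Rightarrow> complex) \<Rightarrow> (real \<Rightarrow> complex) \<Rightarrow> complex) \<Rightarrow>
        (real \<Rightarrow> complex) \<Rightarrow> nat \<Rightarrow> complex"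
where
  "lanczos_phi I ip \<phi>0 0 = \<phi>0"
| "lanczos_phi I ip \<phi>0 (Suc n) =
     cscale (of_real (inverse (lanczos_b I ip \<phi>0 n))) (lanczos_psi I ip \<phi>0 (Suc n))"
| "lanczos_psi I ip \<phi>0 0 = 0"
| "lanczos_psi I ip \<phi>0 (Suc 0) =
     deriv_on I (lanczos_phi I ip \<phi>0 0)
       - cscale (\<i> * lanczos_c I ip \<phi>0 0) (lanczos_phi I ip \<phi>0 0)"
| "lanczos_psi I ip \<phi>0 (Suc (Suc m)) =
     deriv_on I (lanczos_phi I ip \<phi>0 (Suc m))
       + cscale (of_real (lanczos_b I ip \<phi>0 m)) (lanczos_phi I ip \<phi>0 m)
       - cscale (\<i> * lanczos_c I ip \<phi>0 (Suc m)) (lanczos_phi I ip \<phi>0 (Suc m))"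
| "lanczos_b I ip \<phi>0 n = ip_norm ip (lanczos_psi I ip \<phi>0 (Suc n))"
| "lanczos_c I ip \<phi>0 n =
     - \<i> * ip (deriv_on I (lanczos_phi I ip \<phi>0 n)) (lanczos_phi I ip \<phi>0 n)"
  by pat_completeness auto
termination
  by (relation "Wellfounded.measure (\<lambda>x. case x of
        Inl (Inl (_, _, _, n)) \<Rightarrow> 4 * n
      | Inl (Inr (_, _, _, n)) \<Rightarrow> 4 * n - 2
      | Inr (Inl (_, _, _, n)) \<Rightarrow> 4 * n + 3
      | Inr (Inr (_, _, _, n)) \<Rightarrow> 4 * n + 1)") auto

end

theory Submission
  imports Defs
begin

text \<open>
  Applying the IbP property to \<open>\<i> f\<close> as well as to \<open>f\<close> removes the real part, so differentiation
  is skew-adjoint on \<open>\<K>\<^sub>\<infinity>\<close>. Hence \<open>\<langle>\<phi>\<^sub>n', \<phi>\<^sub>j\<rangle> = -\<langle>\<phi>\<^sub>n, \<phi>\<^sub>j'\<rangle>\<close>, and the recurrence for \<open>\<phi>\<^sub>j'\<close> shows that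
  this vanishes for \<open>j < n - 1\<close>, so that two terms suffice to orthogonalise \<open>\<phi>\<^sub>n'\<close>. The algorithm
  cannot break down: if \<open>\<psi>\<^bsub>n+1\<^esub> = 0\<close>, then the span of \<open>\<phi>\<^sub>0, \<dots>, \<phi>\<^sub>n\<close>, which is \<open>\<K>\<^bsub>n+1\<^esub>\<close>, is invariant under
  differentiation, and \<open>\<phi>\<^sub>0\<close> solves an equation of order \<open>n + 1\<close>.
\<close>

declare lanczos_phi.simps [simp del] lanczos_psi.simps [simp del]
  lanczos_b.simps [simp del] lanczos_c.simps [simp del]

section \<open>Finite spans and linearity of the derivative\<close>

text \<open>Coefficients are attached to indices rather than to vectors, so coinciding values of
  \<open>v\<close> do no harm; this is the form in which membership in a Krylov space reads as a
  differential equation.\<close>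

lemma cfun_span_image_lessThan:
  assumes "f \<in> cfun.span (v ` {..<n::nat})"
  shows "\<exists>q. f = (\<Sum>k<n. cscale (q k) (v k))"
  using assms
proof (induction n arbitrary: f)
  case 0
  then show ?case by simp
next
  case (Suc n)
  have "v ` {..<Suc n} = insert (v n) (v ` {..<n})"
    by (simp add: lessThan_Suc)
  with Suc.prems obtain z where "f - cscale z (v n) \<in> cfun.span (v ` {..<n})"
    by (auto simp: cfun.span_breakdown_eq)
  from Suc.IH[OF this] obtain q where q: "f - cscale z (v n) = (\<Sum>k<n. cscale (q k) (v k))"
    by blast
  then have "f = (\<Sum>k<n. cscale (q k) (v k)) + cscale z (v n)"
    by (simp add: algebra_simps)
  also have "\<dots> = (\<Sum>k<Suc n. cscale ((q(n := z)) k) (v k))"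
    by simp
  finally show ?case by blast
qed

lemma deriv_on_add:
  assumes "\<forall>x\<in>I. f differentiable at x" "\<forall>x\<in>I. g differentiable at x"
  shows "deriv_on I (f + g) = deriv_on I f + deriv_on I g"
  using assms by (auto simp: deriv_on_def fun_eq_iff plus_fun_def)

lemma deriv_on_cscale:
  assumes "\<forall>x\<in>I. f differentiable at x"
  shows "deriv_on I (cscale z f) = cscale z (deriv_on I f)"
proof -
  have "vector_derivative (cscale z f) (at x) = z * vector_derivative f (at x)" if "x \<in> I" for x
    unfolding cscale_def
    by (intro vector_derivative_at has_vector_derivative_mult_right)
      (use assms that in \<open>simp add: vector_derivative_works[symmetric]\<close>)
  then show ?thesis
    by (auto simp: deriv_on_def fun_eq_iff cscale_def)
qed

section \<open>The inner product on the Krylov space\<close>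

locale lanczos =
  fixes I :: "real set" and \<phi>0 :: "real \<Rightarrow> complex"
    and ip :: "(real \<Rightarrow> complex) \<Rightarrow> (real \<Rightarrow> complex) \<Rightarrow> complex"
  assumes seed: "seed_function I \<phi>0"
    and ip: "inner_product_on (krylov_inf I \<phi>0) ip"
    and ibp: "ibp_property I \<phi>0 ip"
    and norm_seed: "ip_norm ip \<phi>0 = 1"
begin

abbreviation "V \<equiv> krylov_inf I \<phi>0"
abbreviation "D \<equiv> deriv_on I"
abbreviation "K n \<equiv> krylov I n \<phi>0"
abbreviation "\<phi> \<equiv> lanczos_phi I ip \<phi>0"
abbreviation "\<psi> \<equiv> lanczos_psi I ip \<phi>0"
abbreviation "\<beta> \<equiv> lanczos_b I ip \<phi>0"
abbreviation "\<gamma> \<equiv> lanczos_c I ip \<phi>0"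

lemma subspace_V: "cfun.subspace V"
  by (simp add: krylov_inf_eq_span cfun.subspace_span)

lemmas V_intros = cfun.subspace_0[OF subspace_V] cfun.subspace_add[OF subspace_V]
  cfun.subspace_diff[OF subspace_V] cfun.subspace_scale[OF subspace_V]
  cfun.subspace_neg[OF subspace_V]

lemma K_subset_V: "K n \<subseteq> V"
  unfolding krylov_inf_eq_span krylov_def by (rule cfun.span_mono) auto

lemma ip_add_left: "\<lbrakk>f \<in> V; g \<in> V; h \<in> V\<rbrakk> \<Longrightarrow> ip (f + g) h = ip f h + ip g h"
  using ip[unfolded inner_product_on_def, THEN conjunct1] by simp

lemma ip_scale_left: "\<lbrakk>f \<in> V; g \<in> V\<rbrakk> \<Longrightarrow> ip (cscale z f) g = z * ip f g"
  using ip[unfolded inner_product_on_def, THEN conjunct2, THEN conjunct1] by simp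

lemma ip_commute: "\<lbrakk>f \<in> V; g \<in> V\<rbrakk> \<Longrightarrow> ip g f = cnj (ip f g)"
  using ip[unfolded inner_product_on_def, THEN conjunct2, THEN conjunct2, THEN conjunct1] by metis

lemma ip_pos: "\<lbrakk>f \<in> V; f \<noteq> 0\<rbrakk> \<Longrightarrow> Re (ip f f) > 0"
  using ip[unfolded inner_product_on_def, THEN conjunct2, THEN conjunct2, THEN conjunct2] by simp

lemma ip_diff_left:
  assumes "f \<in> V" "g \<in> V" "h \<in> V"
  shows "ip (f - g) h = ip f h - ip g h"
  using ip_add_left[of "f - g" g h] assms by (simp add: V_intros)

lemma ip_zero_left: "h \<in> V \<Longrightarrow> ip 0 h = 0"
  using ip_diff_left[of 0 0 h] by (simp add: V_intros)

lemma ip_add_right: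
  assumes "f \<in> V" "g \<in> V" "h \<in> V"
  shows "ip h (f + g) = ip h f + ip h g"
  using assms ip_commute[of f h] ip_commute[of g h] ip_commute[of "f + g" h]
  by (simp add: ip_add_left V_intros)

lemma ip_diff_right:
  assumes "f \<in> V" "g \<in> V" "h \<in> V"
  shows "ip h (f - g) = ip h f - ip h g"
  using assms ip_commute[of f h] ip_commute[of g h] ip_commute[of "f - g" h]
  by (simp add: ip_diff_left V_intros)

lemma ip_scale_right:
  assumes "f \<in> V" "g \<in> V"
  shows "ip g (cscale z f) = cnj z * ip g f"
  using assms ip_commute[of f g] ip_commute[of "cscale z f" g]
  by (simp add: ip_scale_left V_intros)

lemma ip_zero_right: "h \<in> V \<Longrightarrow> ip h 0 = 0"
  using ip_commute[of 0 h] by (simp add: ip_zero_left V_intros)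

lemma ip_self_norm:
  assumes "f \<in> V"
  shows "ip f f = of_real ((ip_norm ip f)\<^sup>2)"
proof -
  have "Re (ip f f) \<ge> 0"
    using ip_pos[OF assms] ip_zero_left[OF assms] by (cases "f = 0") auto
  moreover have "Im (ip f f) = 0"
    using arg_cong[OF ip_commute[OF assms assms], of Im] by simp
  ultimately show ?thesis
    by (simp add: ip_norm_def complex_eq_iff)
qed

lemma ip_norm_eq_0_iff:
  assumes "f \<in> V"
  shows "ip_norm ip f = 0 \<longleftrightarrow> f = 0"
  using ip_pos[OF assms] ip_zero_left[OF assms] by (cases "f = 0") (auto simp: ip_norm_def)

lemma ip_span_eq_0:
  assumes "S \<subseteq> V" "w \<in> V" "\<And>s. s \<in> S \<Longrightarrow> ip s w = 0" "f \<in> cfun.span S"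
  shows "ip f w = 0"
proof -
  have "cfun.subspace {f \<in> V. ip f w = 0}"
    by (rule cfun.subspaceI)
      (use assms(2) in \<open>auto simp: V_intros ip_zero_left ip_add_left ip_scale_left\<close>)
  then have "cfun.span S \<subseteq> {f \<in> V. ip f w = 0}"
    using assms by (intro cfun.span_minimal) auto
  then show ?thesis using assms(4) by blast
qed

section \<open>Differentiation on the Krylov space\<close>

lemma differentiable_V:
  assumes "f \<in> V"
  shows "\<forall>x\<in>I. f differentiable at x"
proof -
  have "cfun.subspace {f. \<forall>x\<in>I. f differentiable at x}"
    by (rule cfun.subspaceI) (auto simp: plus_fun_def zero_fun_def cscale_def)
  moreover have "range (\<lambda>k. (D ^^ k) \<phi>0) \<subseteq> {f. \<forall>x\<in>I. f differentiable at x}"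
    using seed by (auto simp: seed_function_def smooth_fun_def)
  ultimately show ?thesis
    using assms cfun.span_minimal unfolding krylov_inf_eq_span by blast
qed

lemma D_add: "\<lbrakk>f \<in> V; g \<in> V\<rbrakk> \<Longrightarrow> D (f + g) = D f + D g"
  by (intro deriv_on_add differentiable_V)

lemma D_scale: "f \<in> V \<Longrightarrow> D (cscale z f) = cscale z (D f)"
  by (intro deriv_on_cscale differentiable_V)

lemma D_zero: "D 0 = 0"
  using D_add[of 0 0] by (simp add: V_intros)

text \<open>Linearity of \<open>D\<close> reduces the claim to generators. Since \<open>D\<close> is
  known to be linear only on \<open>V\<close>, the subspace in the proof is cut down to
  \<open>V\<close>.\<close>

lemma D_span_subset:
  assumes "S \<subseteq> V" "\<And>s. s \<in> S \<Longrightarrow> D s \<in> cfun.span T" "f \<in> cfun.span S"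
  shows "D f \<in> cfun.span T"
proof -
  have "cfun.subspace {f \<in> V. D f \<in> cfun.span T}"
    by (rule cfun.subspaceI)
      (auto simp: V_intros D_zero D_add D_scale cfun.span_zero cfun.span_add cfun.span_scale)
  then have "cfun.span S \<subseteq> {f \<in> V. D f \<in> cfun.span T}"
    using assms by (intro cfun.span_minimal) auto
  then show ?thesis using assms(3) by blast
qed

lemma power_D_seed_in_K: "k < n \<Longrightarrow> (D ^^ k) \<phi>0 \<in> K n"
  unfolding krylov_def by (rule cfun.span_base) auto

lemma power_D_seed_in_V: "(D ^^ k) \<phi>0 \<in> V"
  using K_subset_V power_D_seed_in_K[of k "Suc k"] by blast

lemma D_in_K:
  assumes "f \<in> K n"
  shows "D f \<in> K (Suc n)"
  unfolding krylov_def
proof (rule D_span_subset)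
  show "f \<in> cfun.span ((\<lambda>k. (D ^^ k) \<phi>0) ` {..<n})"
    using assms by (simp add: krylov_def)
  fix s assume "s \<in> (\<lambda>k. (D ^^ k) \<phi>0) ` {..<n}"
  then obtain k where "k < n" "s = (D ^^ k) \<phi>0" by blast
  then show "D s \<in> cfun.span ((\<lambda>k. (D ^^ k) \<phi>0) ` {..<Suc n})"
    by (intro cfun.span_base image_eqI[of _ _ "Suc k"]) auto
qed (use power_D_seed_in_V in blast)

lemma K_mono: "m \<le> n \<Longrightarrow> K m \<subseteq> K n"
  unfolding krylov_def by (rule cfun.span_mono) auto

lemma D_in_V: "f \<in> V \<Longrightarrow> D f \<in> V"
  using D_in_K K_subset_V by (auto simp: krylov_inf_def[of I \<phi>0])

text \<open>Here the seed property enters beyond smoothness: a linear dependence among derivatives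
  of \<open>\<phi>0\<close> is a homogeneous equation with constant coefficients.\<close>

lemma power_D_seed_notin_K: "(D ^^ n) \<phi>0 \<notin> K n"
proof
  assume "(D ^^ n) \<phi>0 \<in> K n"
  then obtain q where q: "(D ^^ n) \<phi>0 = (\<Sum>k<n. cscale (q k) ((D ^^ k) \<phi>0))"
    unfolding krylov_def using cfun_span_image_lessThan by blast
  \<comment> \<open>Moving the n-th derivative to the other side gives it the coefficient -1, so the
    equation is nontrivial.\<close>
  define r where "r = (\<lambda>k. if k = n then - 1 else q k)"
  have "(\<Sum>k\<le>n. r k * (D ^^ k) \<phi>0 x) = 0" for x
  proof -
    have "(\<Sum>k\<le>n. r k * (D ^^ k) \<phi>0 x) = (\<Sum>k<n. q k * (D ^^ k) \<phi>0 x) - (D ^^ n) \<phi>0 x"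
      by (simp add: r_def lessThan_Suc_atMost[symmetric])
    also have "(\<Sum>k<n. q k * (D ^^ k) \<phi>0 x) = (\<Sum>k<n. cscale (q k) ((D ^^ k) \<phi>0)) x"
      by (induction n) (simp_all add: cscale_def)
    finally show ?thesis using q by simp
  qed
  moreover have "r n \<noteq> 0" by (simp add: r_def)
  ultimately show False
    using seed unfolding seed_function_def by blast
qed

lemma D_skew:
  assumes "f \<in> V" "g \<in> V"
  shows "ip (D f) g = - ip f (D g)"
proof -
  have *: "Re (ip (D f) g + ip f (D g)) = 0" if "f \<in> V" for f
    using ibp that assms(2) by (auto simp: ibp_property_def)
  \<comment> \<open>Both terms are linear in \<open>f\<close>, so passing to \<open>\<i>\<close>
    times \<open>f\<close> multiplies the sum by \<open>\<i>\<close>; its imaginary part vanishes as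
    well.\<close>
  have "Re (\<i> * (ip (D f) g + ip f (D g))) = 0"
    using *[of "cscale \<i> f"] assms
    by (simp add: D_scale ip_scale_left D_in_V V_intros)
  with *[OF assms(1)] show ?thesis
    by (simp add: complex_eq_iff)
qed

section \<open>The three-term recurrence\<close>

text \<open>The term \<open>b\<^bsub>n-1\<^esub> \<phi>\<^bsub>n-1\<^esub>\<close> with the convention \<open>b\<^bsub>-1\<^esub> \<phi>\<^bsub>-1\<^esub> = 0\<close>.\<close>

definition prev :: "nat \<Rightarrow> real \<Rightarrow> complex"
  where "prev n = (if n = 0 then 0 else cscale (of_real (\<beta> (n - 1))) (\<phi> (n - 1)))"

lemma psi_Suc: "\<psi> (Suc n) = D (\<phi> n) + prev n - cscale (\<i> * \<gamma> n) (\<phi> n)"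
  by (cases n) (simp_all add: prev_def lanczos_psi.simps)

lemma phi_psi_in_K: "\<phi> n \<in> K (Suc n) \<and> \<psi> (Suc n) \<in> K (Suc (Suc n))"
proof (induction n rule: less_induct)
  case (less n)
  have phi: "\<phi> n \<in> K (Suc n)"
  proof (cases n)
    case 0
    then show ?thesis using power_D_seed_in_K[of 0 1] by (simp add: lanczos_phi.simps)
  next
    case (Suc m)
    then show ?thesis using less[of m]
      by (simp add: lanczos_phi.simps krylov_def cfun.span_scale)
  qed
  have "prev n \<in> K (Suc (Suc n))"
  proof (cases n)
    case 0
    then show ?thesis by (simp add: prev_def krylov_def cfun.span_zero)
  next
    case (Suc m)
    then have "\<phi> m \<in> K (Suc (Suc n))"
      using less[of m] K_mono[of "Suc m" "Suc (Suc n)"] by auto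
    then show ?thesis using Suc
      by (simp add: prev_def krylov_def cfun.span_scale)
  qed
  moreover have "\<phi> n \<in> K (Suc (Suc n))" "D (\<phi> n) \<in> K (Suc (Suc n))"
    using phi K_mono[of "Suc n" "Suc (Suc n)"] D_in_K by auto
  ultimately have "\<psi> (Suc n) \<in> K (Suc (Suc n))"
    unfolding psi_Suc krylov_def
    by (intro cfun.span_add cfun.span_diff cfun.span_scale)
  with phi show ?case by blast
qed

lemma phi_in_V: "\<phi> n \<in> V" and psi_in_V: "\<psi> (Suc n) \<in> V"
  using phi_psi_in_K[of n] K_subset_V by blast+

lemma prev_in_V: "prev n \<in> V"
  by (simp add: prev_def V_intros phi_in_V)

text \<open>This holds even in the case of a breakdown, where both sides vanish.\<close>

lemma psi_eq_scale_phi: "\<psi> (Suc n) = cscale (of_real (\<beta> n)) (\<phi> (Suc n))"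
proof (cases "\<beta> n = 0")
  case True
  then have "\<psi> (Suc n) = 0"
    using ip_norm_eq_0_iff[OF psi_in_V] by (simp add: lanczos_b.simps)
  with True show ?thesis by (simp add: cscale_def fun_eq_iff)
next
  case False
  then show ?thesis by (simp add: lanczos_phi.simps)
qed

lemma D_phi: "D (\<phi> n) = - prev n + cscale (\<i> * \<gamma> n) (\<phi> n) + cscale (of_real (\<beta> n)) (\<phi> (Suc n))"
  using psi_Suc[of n] by (simp add: psi_eq_scale_phi algebra_simps)

section \<open>Orthonormality of the Lanczos functions\<close>

definition orthonormal_upto :: "nat \<Rightarrow> bool"
  where "orthonormal_upto n \<longleftrightarrow> (\<forall>i\<le>n. \<forall>j\<le>n. ip (\<phi> i) (\<phi> j) = (if i = j then 1 else 0))"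

lemma ip_prev_right:
  assumes "orthonormal_upto n" "j \<le> n"
  shows "ip (\<phi> n) (prev j) = 0"
  using assms
  by (auto simp: prev_def orthonormal_upto_def ip_zero_right ip_scale_right phi_in_V)

lemma ip_prev_left:
  assumes "orthonormal_upto n" "j \<le> n"
  shows "ip (prev n) (\<phi> j) = (if Suc j = n then of_real (\<beta> j) else 0)"
  using assms
  by (auto simp: prev_def orthonormal_upto_def ip_zero_left ip_scale_left phi_in_V)

lemma ip_psi_phi:
  assumes on: "orthonormal_upto n" and j: "j \<le> n"
  shows "ip (\<psi> (Suc n)) (\<phi> j) = 0"
proof -
  have "ip (\<psi> (Suc n)) (\<phi> j) =
      ip (D (\<phi> n)) (\<phi> j) + ip (prev n) (\<phi> j) - \<i> * \<gamma> n * ip (\<phi> n) (\<phi> j)"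
    by (simp add: psi_Suc ip_add_left ip_diff_left ip_scale_left V_intros D_in_V phi_in_V prev_in_V)
  also have "\<dots> = 0"
  proof (cases "j = n")
    \<comment> \<open>The coefficient \<open>\<i> * \<gamma> n\<close> equals
      \<open>ip (D (\<phi> n)) (\<phi> n)\<close>, so the first and last terms cancel.\<close>
    case True
    then show ?thesis
      using ip_prev_left[OF on j] on by (simp add: orthonormal_upto_def lanczos_c.simps)
  next
    case False
    with j have "j < n" by simp
    have "ip (D (\<phi> n)) (\<phi> j) = - ip (\<phi> n) (D (\<phi> j))"
      by (simp add: D_skew phi_in_V)
    also have "D (\<phi> j) =
        cscale (\<i> * \<gamma> j) (\<phi> j) + cscale (of_real (\<beta> j)) (\<phi> (Suc j)) - prev j"
      by (simp add: D_phi)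
    \<comment> \<open>Only \<open>\<phi> (Suc j)\<close> can reach index \<open>n\<close>. Its
      coefficient is real, hence unchanged by conjugation, and after the sign from skewness it
      cancels the \<open>prev n\<close> term.\<close>
    also have "ip (\<phi> n) \<dots> = (if Suc j = n then of_real (\<beta> j) else 0)"
      using on \<open>j < n\<close>
      by (auto simp: ip_add_right ip_diff_right ip_scale_right ip_prev_right V_intros phi_in_V
          prev_in_V orthonormal_upto_def)
    finally show ?thesis
      using ip_prev_left[OF on j] on \<open>j < n\<close> by (auto simp: orthonormal_upto_def)
  qed
  finally show ?thesis .
qed

lemma orthonormal_upto_Suc:
  assumes on: "orthonormal_upto n" and "\<beta> n \<noteq> 0"
  shows "orthonormal_upto (Suc n)"
proof -
  have phi: "\<phi> (Suc n) = cscale (of_real (inverse (\<beta> n))) (\<psi> (Suc n))"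
    by (simp add: lanczos_phi.simps)
  have *: "ip (\<phi> (Suc n)) (\<phi> j) = 0" if "j \<le> n" for j
    using ip_psi_phi[OF on that] by (simp add: phi ip_scale_left psi_in_V phi_in_V)
  have **: "ip (\<phi> j) (\<phi> (Suc n)) = 0" if "j \<le> n" for j
    using *[OF that] ip_commute[OF phi_in_V phi_in_V, of "Suc n" j] by simp
  have "ip (\<psi> (Suc n)) (\<psi> (Suc n)) = of_real ((\<beta> n)\<^sup>2)"
    by (simp add: ip_self_norm psi_in_V lanczos_b.simps)
  then have "ip (\<phi> (Suc n)) (\<phi> (Suc n)) = 1"
    using \<open>\<beta> n \<noteq> 0\<close>
    by (simp add: phi ip_scale_left ip_scale_right psi_in_V V_intros power2_eq_square field_simps)
  then show ?thesis
    using on * ** by (auto simp: orthonormal_upto_def le_Suc_eq)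
qed

section \<open>Krylov spaces as spans, and absence of breakdown\<close>

lemma D_phi_in_span: "D (\<phi> i) \<in> cfun.span (\<phi> ` {..Suc i})"
proof -
  have "\<phi> j \<in> cfun.span (\<phi> ` {..Suc i})" if "j \<le> Suc i" for j
    using that by (intro cfun.span_base) auto
  then show ?thesis
    unfolding D_phi prev_def
    by (auto intro!: cfun.span_add cfun.span_diff cfun.span_neg cfun.span_scale cfun.span_zero)
qed

text \<open>By the recurrence, \<open>D\<close> raises the index by at most one, so induction
  captures every derivative of the seed. Neither orthonormality nor
  \<open>\<beta> n \<noteq> 0\<close> is assumed, so the result can serve to exclude a
  breakdown.\<close>

lemma span_phi: "cfun.span (\<phi> ` {..n}) = K (Suc n)"
proof
  have "\<phi> i \<in> K (Suc n)" if "i \<le> n" for i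
    using phi_psi_in_K[of i] K_mono[of "Suc i" "Suc n"] that by auto
  then show "cfun.span (\<phi> ` {..n}) \<subseteq> K (Suc n)"
    unfolding krylov_def by (intro cfun.span_minimal cfun.subspace_span) auto
  have mono: "cfun.span (\<phi> ` {..k}) \<subseteq> cfun.span (\<phi> ` {..m})" if "k \<le> m" for k m
    using that by (intro cfun.span_mono) auto
  have "(D ^^ k) \<phi>0 \<in> cfun.span (\<phi> ` {..k})" for k
  proof (induction k)
    case 0
    then show ?case by (simp add: lanczos_phi.simps cfun.span_base)
  next
    case (Suc k)
    have "D ((D ^^ k) \<phi>0) \<in> cfun.span (\<phi> ` {..Suc k})"
    proof (rule D_span_subset[OF _ _ Suc])
      fix s assume "s \<in> \<phi> ` {..k}"
      then obtain i where "i \<le> k" "s = \<phi> i" by blast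
      then show "D s \<in> cfun.span (\<phi> ` {..Suc k})"
        using D_phi_in_span[of i] mono[of "Suc i" "Suc k"] by auto
    qed (use phi_in_V in blast)
    then show ?case by simp
  qed
  then have "(D ^^ k) \<phi>0 \<in> cfun.span (\<phi> ` {..n})" if "k < Suc n" for k
    using mono[of k n] that by auto
  then show "K (Suc n) \<subseteq> cfun.span (\<phi> ` {..n})"
    unfolding krylov_def by (intro cfun.span_minimal cfun.subspace_span) auto
qed

text \<open>If \<open>b\<^sub>n = 0\<close>, then \<open>\<phi>\<^bsub>n+1\<^esub> = 0\<close>, and the Krylov spaces stop growing.\<close>

lemma beta_nonzero: "\<beta> n \<noteq> 0"
proof
  assume "\<beta> n = 0"
  then have "\<phi> (Suc n) = 0"
    by (simp add: lanczos_phi.simps cscale_def fun_eq_iff)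
  then have "cfun.span (\<phi> ` {..Suc n}) = cfun.span (\<phi> ` {..n})"
    by (simp add: atMost_Suc)
  then show False
    using power_D_seed_notin_K[of "Suc n"] power_D_seed_in_K[of "Suc n" "Suc (Suc n)"]
    by (simp add: span_phi)
qed

lemma orthonormal_upto: "orthonormal_upto n"
proof (induction n)
  case 0
  show ?case
    using ip_self_norm[OF phi_in_V, of 0] norm_seed
    by (simp add: orthonormal_upto_def lanczos_phi.simps)
qed (intro orthonormal_upto_Suc beta_nonzero)

lemma orthonormal_basis: "orthonormal_basis ip (K (Suc n)) n \<phi>"
proof -
  have "cfun.independent (\<phi> ` {..n})"
    unfolding cfun.dependent_def
  proof
    assume "\<exists>a\<in>\<phi> ` {..n}. a \<in> cfun.span (\<phi> ` {..n} - {a})"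
    then obtain k where k: "k \<le> n" "\<phi> k \<in> cfun.span (\<phi> ` {..n} - {\<phi> k})" by blast
    \<comment> \<open>A vector in the span of vectors orthogonal to it is orthogonal to
      itself.\<close>
    have "ip (\<phi> k) (\<phi> k) = 0"
    proof (rule ip_span_eq_0[OF _ _ _ k(2)])
      fix s assume "s \<in> \<phi> ` {..n} - {\<phi> k}"
      then show "ip s (\<phi> k) = 0"
        using orthonormal_upto[of n] k(1) by (auto simp: orthonormal_upto_def)
    qed (use phi_in_V in auto)
    then show False
      using orthonormal_upto[of n] k(1) by (auto simp: orthonormal_upto_def)
  qed
  then show ?thesis
    using orthonormal_upto[of n]
    by (simp add: orthonormal_basis_def orthonormal_upto_def span_phi)
qed

end

text \<open>The first conjunct expresses that the algorithm is well defined: the form is evaluated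
  only inside the Krylov space, where it is constrained, and no division relies on
  \<open>inverse 0 = 0\<close>.\<close>

theorem theorem7:
  fixes a b :: ereal
    and \<phi>0 :: "real \<Rightarrow> complex"
    and ip :: "(real \<Rightarrow> complex) \<Rightarrow> (real \<Rightarrow> complex) \<Rightarrow> complex"
  defines "I \<equiv> einterval a b"
  defines "\<phi> \<equiv> lanczos_phi I ip \<phi>0"
    and "\<psi> \<equiv> lanczos_psi I ip \<phi>0"
    and "\<beta> \<equiv> lanczos_b I ip \<phi>0"
    and "\<gamma> \<equiv> lanczos_c I ip \<phi>0"
  assumes "a < b"
    and "seed_function I \<phi>0"
    and "inner_product_on (krylov_inf I \<phi>0) ip"
    and "ibp_property I \<phi>0 ip"
    and "ip_norm ip \<phi>0 = 1"
  shows "(\<forall>n. \<phi> n \<in> krylov_inf I \<phi>0 \<and> deriv_on I (\<phi> n) \<in> krylov_inf I \<phi>0 \<and>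
              \<psi> (Suc n) \<in> krylov_inf I \<phi>0 \<and> \<beta> n \<noteq> 0) \<and>
         (\<forall>n\<ge>1.
            orthonormal_basis ip (krylov I (n + 1) \<phi>0) n \<phi> \<and>
            deriv_on I (\<phi> (n - 1)) =
              - (if n = 1 then 0 else cscale (of_real (\<beta> (n - 2))) (\<phi> (n - 2)))
              + cscale (\<i> * \<gamma> (n - 1)) (\<phi> (n - 1))
              + cscale (of_real (\<beta> (n - 1))) (\<phi> n))"
proof -
  interpret lanczos I \<phi>0 ip
    by (unfold_locales) fact+
  have "deriv_on I (\<phi> (n - 1)) =
      - (if n = 1 then 0 else cscale (of_real (\<beta> (n - 2))) (\<phi> (n - 2)))
      + cscale (\<i> * \<gamma> (n - 1)) (\<phi> (n - 1)) + cscale (of_real (\<beta> (n - 1))) (\<phi> n)"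
    if "n \<ge> 1" for n
  proof -
    \<comment> \<open>The recurrence \<open>D_phi\<close> at \<open>m\<close> is the one for
      \<open>n - 1\<close>; its term \<open>prev m\<close> vanishes exactly by convention when
      \<open>n = 1\<close>.\<close>
    from that obtain m where n: "n = Suc m" by (cases n) auto
    show ?thesis
      using D_phi[of m]
      by (simp add: n prev_def numeral_2_eq_2 \<phi>_def \<beta>_def \<gamma>_def)
  qed
  then show ?thesis
    unfolding \<phi>_def \<psi>_def \<beta>_def \<gamma>_def
    using phi_in_V psi_in_V D_in_V beta_nonzero orthonormal_basis by simp
qed

end
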